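(* Let $u>0$ be known, $n_0>0$ and $0<g_0<1$. Let $X=(x_1,\dots,x_n)$, $n\ge1$, be observations with $0<x_i<u$ that are i.i.d. given $\alpha>0$, each with the Power density $p(x_i\mid\alpha)=\mathrm{Power}(x_i\mid u,\alpha)$. Suppose $\alpha$ has prior distribution $\Gamma(n_0,\ -n_0\log g_0)$. Let $\hat g=\prod_{i=1}^n\left(\frac{x_i}{u}\right)^{1/n}$ and $g_n=\left(g_0^{n_0}\hat g^{\,n}\right)^{1/(n+n_0)}$. Then the posterior distribution of $\alpha$ is $$p(\alpha\mid X)=\Gamma\big(\alpha\mid n+n_0,\ -(n+n_0)\log g_n\big).$$ Moreover, with $A=n+n_0$ and $B=-(n+n_0)\log g_n$, one has $B>0$ and the predictive density of a new observation $x$ is $$p(x\mid X)=\frac{A B^{A}}{x\left(B+\log\frac{u}{x}\right)^{A+1}}\qquad(0<x<u),$$ i.e. conditionally on $X$ the random variable $-\log\frac{x}{u}+B$ has distribution $\mathrm{Pareto}(A,B)$.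
   Context: For $a,b>0$, $\mathrm{Power}(x\mid a,b)=\frac{b x^{b-1}}{a^{b}}$ for $0<x<a$ and $0$ otherwise. $\Gamma(a,b)$ (with $a,b>0$) is the Gamma distribution with shape $a$ and rate $b$: density $\Gamma(\alpha\mid a,b)=\frac{b^a}{\Gamma(a)}\alpha^{a-1}e^{-b\alpha}$ for $\alpha>0$. $\mathrm{Pareto}(a,b)$ (with $a,b>0$) has density $\frac{a b^{a}}{y^{a+1}}$ for $y>b$ and $0$ otherwise. The posterior is $p(\alpha\mid X)=p(X\mid\alpha)p(\alpha)\big/\int_0^\infty p(X\mid\alpha)p(\alpha)\,d\alpha$ with $p(X\mid\alpha)=\prod_i p(x_i\mid\alpha)$. The predictive density is $p(x\mid X)=\int_0^\infty p(x\mid\alpha)p(\alpha\mid X)\,d\alpha$. *)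

theory Defs
  imports "HOL-Probability.Probability"
begin

definition power_density :: "real \<Rightarrow> real \<Rightarrow> real \<Rightarrow> real" where
  "power_density a b x = (if 0 < x \<and> x < a then b * x powr (b - 1) / a powr b else 0)"

text \<open>Shape \<open>a\<close> and rate \<open>b\<close>.  The shape is an arbitrary positive real, which the
  library's \<open>erlang_density\<close> does not cover.\<close>

definition gamma_density :: "real \<Rightarrow> real \<Rightarrow> real \<Rightarrow> real" where
  "gamma_density a b t =
     (if 0 < t then b powr a / Gamma a * t powr (a - 1) * exp (- b * t) else 0)"

definition pareto_density :: "real \<Rightarrow> real \<Rightarrow> real \<Rightarrow> real" where
  "pareto_density a b y = (if b < y then a * b powr a / y powr (a + 1) else 0)"

text \<open>A parametric model is a family \<open>f\<close>, where \<open>f \<alpha>\<close> is the density of one observation given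
  the parameter value \<open>\<alpha> > 0\<close>; the observations \<open>x 1, \<dots>, x n\<close> are i.i.d. given \<open>\<alpha>\<close>, so their
  joint density given \<open>\<alpha>\<close> is the product.\<close>

definition likelihood :: "(real \<Rightarrow> real \<Rightarrow> real) \<Rightarrow> nat \<Rightarrow> (nat \<Rightarrow> real) \<Rightarrow> real \<Rightarrow> real" where
  "likelihood f n x \<alpha> = (\<Prod>i=1..n. f \<alpha> (x i))"

definition posterior_density ::
  "(real \<Rightarrow> real \<Rightarrow> real) \<Rightarrow> (real \<Rightarrow> real) \<Rightarrow> nat \<Rightarrow> (nat \<Rightarrow> real) \<Rightarrow> real \<Rightarrow> real" where
  "posterior_density f prior n x \<alpha> =
     likelihood f n x \<alpha> * prior \<alpha> / (LBINT t:{0<..}. likelihood f n x t * prior t)"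

definition predictive_density ::
  "(real \<Rightarrow> real \<Rightarrow> real) \<Rightarrow> (real \<Rightarrow> real) \<Rightarrow> nat \<Rightarrow> (nat \<Rightarrow> real) \<Rightarrow> real \<Rightarrow> real" where
  "predictive_density f prior n x y =
     (LBINT t:{0<..}. f t y * posterior_density f prior n x t)"

end

theory Submission
  imports Defs
begin

text \<open>As a function of \<open>t\<close>, \<open>power_density u t x = t * exp (t * ln (x / u)) / x\<close>. Each observation
  therefore raises the shape of a Gamma density by one and its rate by \<open>- ln (x / u)\<close>; the posterior
  and, after one more observation, the predictive density are read off the normalising constants.
  With \<open>X y = b - ln (y / u)\<close>, the Pareto survival function \<open>(b / w) powr a\<close> evaluated at \<open>w = X y\<close> is
  an antiderivative of the predictive density, so the distribution functions agree.\<close>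

section \<open>The Power likelihood in exponential form\<close>

lemma power_density_eq_exp:
  assumes "0 < x" "x < u"
  shows "power_density u t x = t * exp (t * ln (x / u)) / x"
  using assms
  by (simp add: power_density_def powr_def ln_div algebra_simps exp_diff exp_add)

lemma power_density_eq_0:
  assumes "\<not> (0 < x \<and> x < u)"
  shows "power_density u t x = 0"
  using assms by (auto simp: power_density_def)

lemma likelihood_power_density:
  assumes "\<And>i. i \<in> {1..n} \<Longrightarrow> 0 < x i \<and> x i < u"
  shows "likelihood (power_density u) n x t
           = t ^ n * exp (t * (\<Sum>i=1..n. ln (x i / u))) / (\<Prod>i=1..n. x i)"
proof -
  have "likelihood (power_density u) n x t = (\<Prod>i=1..n. t * exp (t * ln (x i / u)) / x i)"
    unfolding likelihood_def by (intro prod.cong) (use assms power_density_eq_exp in auto)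
  also have "\<dots> = t ^ n * exp (t * (\<Sum>i=1..n. ln (x i / u))) / (\<Prod>i=1..n. x i)"
    by (simp add: prod_dividef prod.distrib exp_sum sum_distrib_left)
  finally show ?thesis .
qed

section \<open>Normalising constants of Gamma densities\<close>

lemma nn_integral_gamma_kernel:
  fixes a b :: real
  assumes "a > 0" "b > 0"
  shows "(\<integral>\<^sup>+t. ennreal (indicator {0<..} t * (t powr (a - 1) * exp (- b * t))) \<partial>lborel)
           = ennreal (Gamma a / b powr a)"
proof -
  let ?k = "\<lambda>t. indicator {0..} t * t powr (a - 1) / exp t :: real"
  \<comment> \<open>Euler's integrand lives on \<open>{0..}\<close>, the kernel on
    \<open>{0<..}\<close>. They agree at \<open>t = 0\<close> too, since
    \<open>0 powr (a - 1) = 0\<close> for every \<open>a\<close>.\<close>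
  have eq: "?k (0 + b * t) = b powr (a - 1) * (indicator {0<..} t * (t powr (a - 1) * exp (- b * t)))"
    for t using assms
    by (cases "t > 0"; cases "t = 0")
       (auto simp: indicator_def powr_mult exp_minus field_simps zero_le_mult_iff)
  have "ennreal (Gamma a) = (\<integral>\<^sup>+t. ennreal (?k t) \<partial>lborel)"
    by (rule Gamma_conv_nn_integral_real) fact
  \<comment> \<open>Substitution \<open>s = b * t\<close> in Euler's integral. The Jacobian
    \<open>b\<close> and the factor \<open>b powr (a - 1)\<close> combine to
    \<open>b powr a\<close>. Working with the nonnegative integral avoids any integrability
    argument.\<close>
  also have "\<dots> = ennreal b * (\<integral>\<^sup>+t. ennreal (?k (0 + b * t)) \<partial>lborel)"
    using assms by (subst nn_integral_real_affine[where c = b and t = 0]) auto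
  also have "\<dots> = ennreal b * (ennreal (b powr (a - 1)) *
      (\<integral>\<^sup>+t. ennreal (indicator {0<..} t * (t powr (a - 1) * exp (- b * t))) \<partial>lborel))"
    unfolding eq by (subst ennreal_mult) (auto simp: nn_integral_cmult)
  also have "\<dots> = ennreal (b powr a) *
      (\<integral>\<^sup>+t. ennreal (indicator {0<..} t * (t powr (a - 1) * exp (- b * t))) \<partial>lborel)"
    using assms by (simp add: mult.assoc[symmetric] ennreal_mult[symmetric] powr_diff)
  finally have *: "ennreal (Gamma a) = ennreal (b powr a) *
      (\<integral>\<^sup>+t. ennreal (indicator {0<..} t * (t powr (a - 1) * exp (- b * t))) \<partial>lborel)" .
  have "ennreal (Gamma a / b powr a) = ennreal (1 / b powr a) * ennreal (Gamma a)"
    using assms by (simp add: ennreal_mult[symmetric] Gamma_real_pos less_imp_le)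
  also have "\<dots> = (\<integral>\<^sup>+t. ennreal (indicator {0<..} t * (t powr (a - 1) * exp (- b * t))) \<partial>lborel)"
    using assms unfolding * by (simp add: mult.assoc[symmetric] ennreal_mult[symmetric])
  finally show ?thesis by simp
qed

lemma set_integral_gamma_kernel:
  fixes a b :: real
  assumes "a > 0" "b > 0"
  shows "(LBINT t:{0<..}. t powr (a - 1) * exp (- b * t)) = Gamma a / b powr a"
  unfolding set_lebesgue_integral_def
  using assms nn_integral_gamma_kernel[OF assms]
  by (subst integral_eq_nn_integral) (auto simp: Gamma_real_pos less_imp_le)

lemma set_integral_gamma_density:
  assumes "a > 0" "b > 0"
  shows "(LBINT t:{0<..}. gamma_density a b t) = 1"
proof -
  have "(LBINT t:{0<..}. gamma_density a b t)
      = (LBINT t:{0<..}. b powr a / Gamma a * (t powr (a - 1) * exp (- b * t)))"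
    by (intro set_lebesgue_integral_cong) (auto simp: gamma_density_def)
  also have "\<dots> = b powr a / Gamma a * (Gamma a / b powr a)"
    using set_integral_gamma_kernel[OF assms] by simp
  also have "\<dots> = 1"
    using assms Gamma_real_pos[of a] by (simp add: order_less_imp_not_eq2)
  finally show ?thesis .
qed

section \<open>Bayesian updating under a Gamma prior\<close>

lemma posterior_density_eqI:
  assumes "\<And>t. likelihood f n x t * prior t = C * g t" "C \<noteq> 0"
    and "(LBINT t:{0<..}. g t) = 1"
  shows "posterior_density f prior n x = g"
  using assms by (auto simp: posterior_density_def)

text \<open>Conjugacy: powers of \<open>t\<close> and exponents add up, so the product is again a
  Gamma kernel. The constant is the prior's normalising factor over the product of the data, divided
  by the normalising factor of the new Gamma density.\<close>

lemma likelihood_power_gamma: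
  assumes x: "\<And>i. i \<in> {1..n} \<Longrightarrow> 0 < x i \<and> x i < u"
    and "a > 0" and "B = b - (\<Sum>i=1..n. ln (x i / u))" and "B > 0"
  shows "likelihood (power_density u) n x t * gamma_density a b t
    = b powr a / Gamma a / (\<Prod>i=1..n. x i) * (Gamma (real n + a) / B powr (real n + a))
        * gamma_density (real n + a) B t"
proof (cases "t > 0")
  case True
  have "Gamma (real n + a) > 0"
    using assms by (intro Gamma_real_pos) auto
  moreover have "t ^ n * t powr (a - 1) = t powr (real n + a - 1)"
    using True by (simp add: powr_realpow[symmetric] powr_add[symmetric] algebra_simps)
  moreover have "exp (t * (\<Sum>i=1..n. ln (x i / u))) * exp (- b * t) = exp (- B * t)"
    by (simp add: assms exp_add[symmetric] algebra_simps)
  moreover have "likelihood (power_density u) n x t * gamma_density a b t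
      = b powr a / Gamma a / (\<Prod>i=1..n. x i) * ((t ^ n * t powr (a - 1))
          * (exp (t * (\<Sum>i=1..n. ln (x i / u))) * exp (- b * t)))"
    using True by (subst likelihood_power_density) (simp_all add: x gamma_density_def mult_ac)
  ultimately show ?thesis
    using True \<open>B > 0\<close> by (simp add: gamma_density_def)
\<comment> \<open>For \<open>t \<le> 0\<close> both Gamma densities vanish, whatever the likelihood
  is.\<close>
qed (simp add: gamma_density_def)

text \<open>One more observation turns the integrand into a Gamma kernel of shape
  \<open>a + 1\<close> and rate \<open>b + ln (u / y)\<close>. The factor \<open>a\<close> comes
  from \<open>Gamma (a + 1) = a * Gamma a\<close>.\<close>

lemma set_integral_power_gamma:
  assumes "a > 0" "b > 0" "0 < y" "y < u"
  shows "(LBINT t:{0<..}. power_density u t y * gamma_density a b t)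
    = a * b powr a / (y * (b + ln (u / y)) powr (a + 1))"
proof -
  let ?c = "b + ln (u / y)"
  have c: "?c > 0" using assms by (simp add: add_pos_pos)
  have "(LBINT t:{0<..}. power_density u t y * gamma_density a b t)
      = (LBINT t:{0<..}. b powr a / Gamma a / y * (t powr (a + 1 - 1) * exp (- ?c * t)))"
  proof (intro set_lebesgue_integral_cong allI impI)
    fix t :: real assume "t \<in> {0<..}"
    then have t: "t > 0" by simp
    have "t * t powr (a - 1) = t powr a"
      using t by (simp add: powr_diff)
    moreover have "exp (t * ln (y / u)) * exp (- b * t) = exp (- ?c * t)"
      using assms by (simp add: ln_div exp_add[symmetric] algebra_simps)
    moreover have "power_density u t y * gamma_density a b t
        = b powr a / Gamma a / y * ((t * t powr (a - 1)) * (exp (t * ln (y / u)) * exp (- b * t)))"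
      using t assms by (simp add: power_density_eq_exp gamma_density_def mult_ac)
    ultimately show "power_density u t y * gamma_density a b t
        = b powr a / Gamma a / y * (t powr (a + 1 - 1) * exp (- ?c * t))"
      by simp
  qed simp
  also have "\<dots> = b powr a / Gamma a / y * (Gamma (a + 1) / ?c powr (a + 1))"
    using set_integral_gamma_kernel[of "a + 1" ?c] assms c by simp
  also have "\<dots> = a * b powr a / (y * ?c powr (a + 1))"
  proof -
    have "a \<notin> \<int>\<^sub>\<le>\<^sub>0"
      using assms by (auto elim!: nonpos_Ints_cases)
    moreover have "Gamma a \<noteq> 0"
      using Gamma_real_pos[of a] assms by linarith
    ultimately show ?thesis
      using Gamma_plus1[of a] by simp
  qed
  finally show ?thesis .
qed

section \<open>The Pareto law of the transformed observation\<close>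

lemma pareto_tail_has_derivative:
  fixes a b w :: real
  assumes "w > 0"
  shows "((\<lambda>w. - (b powr a) * w powr (- a)) has_real_derivative a * b powr a / w powr (a + 1)) (at w)"
  using assms
  by (auto intro!: derivative_eq_intros simp: powr_minus powr_diff powr_add field_simps)

lemma pareto_density_nonneg:
  "a > 0 \<Longrightarrow> 0 \<le> pareto_density a b y"
  by (simp add: pareto_density_def)

lemma pareto_density_measurable [measurable]:
  "pareto_density a b \<in> borel_measurable borel"
  unfolding pareto_density_def by measurable

lemma nn_integral_pareto_density_atMost:
  assumes "a > 0" "b > 0"
  shows "(\<integral>\<^sup>+y. pareto_density a b y * indicator {..z} y \<partial>lborel)
    = ennreal (if z < b then 0 else 1 - b powr a * z powr (- a))"
proof (cases "z < b")
  case True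
  then have *: "pareto_density a b y * indicator {..z} y = 0" for y
    by (auto simp: pareto_density_def indicator_def)
  show ?thesis
    unfolding * using True by simp
next
  case False
  \<comment> \<open>The support is open at \<open>b\<close>, where the formula is not zero. Closing
    the interval for the fundamental theorem changes the integrand only at that one point.\<close>
  have "(\<integral>\<^sup>+y. pareto_density a b y * indicator {..z} y \<partial>lborel)
    = (\<integral>\<^sup>+y. ennreal (a * b powr a / y powr (a + 1)) * indicator {b..z} y \<partial>lborel)"
    by (intro nn_integral_cong_AE eventually_mono[OF AE_lborel_singleton[of b]])
       (auto simp: pareto_density_def indicator_def)
  also have "\<dots> = ennreal (- (b powr a) * z powr (- a) - (- (b powr a) * b powr (- a)))"
    using assms False
    by (intro nn_integral_FTC_Icc pareto_tail_has_derivative) auto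
  also have "- (b powr a) * z powr (- a) - (- (b powr a) * b powr (- a))
      = 1 - b powr a * z powr (- a)"
    using assms by (simp add: powr_minus)
  finally show ?thesis using False by simp
qed

text \<open>It suffices to compare distribution functions. The map
  \<open>y \<mapsto> - ln (y / u) + b\<close> decreases from \<open>(0, u)\<close> onto the
  half-line above \<open>b\<close>, so its lower events are upper intervals in
  \<open>y\<close>.\<close>

lemma distributed_neg_log_pareto:
  fixes a b u :: real and p :: "real \<Rightarrow> real"
  assumes "a > 0" "b > 0" "u > 0"
    and p: "\<And>y. p y = (if 0 < y \<and> y < u then a * b powr a / (y * (b + ln (u / y)) powr (a + 1)) else 0)"
  shows "distributed (density lborel (\<lambda>y. ennreal (p y))) lborel
           (\<lambda>y. - ln (y / u) + b) (\<lambda>z. ennreal (pareto_density a b z))"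
proof (rule distributedI_borel_atMost)
  let ?X = "\<lambda>y. - ln (y / u) + b"
  have p_fun: "p = (\<lambda>y. if 0 < y \<and> y < u then a * b powr a / (y * (b + ln (u / y)) powr (a + 1)) else 0)"
    using p by blast
  have [measurable]: "p \<in> borel_measurable borel"
    unfolding p_fun by measurable
  show "?X \<in> borel_measurable (density lborel (\<lambda>y. ennreal (p y)))"
    by simp
  show "pareto_density a b \<in> borel_measurable borel"
    by simp
  show "AE z in lborel. 0 \<le> pareto_density a b z"
    using assms by (simp add: pareto_density_nonneg)
  show "(\<integral>\<^sup>+y. pareto_density a b y * indicator {..z} y \<partial>lborel)
      = ennreal (if z < b then 0 else 1 - b powr a * z powr (- a))" for z
    using assms(1,2) by (rule nn_integral_pareto_density_atMost)
  fix z
  have "emeasure (density lborel (\<lambda>y. ennreal (p y)))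
          {y \<in> space (density lborel (\<lambda>y. ennreal (p y))). ?X y \<le> z}
      = (\<integral>\<^sup>+y. ennreal (p y) * indicator {y. ?X y \<le> z} y \<partial>lborel)"
    by (simp add: emeasure_density)
  also have "\<dots> = ennreal (if z < b then 0 else 1 - b powr a * z powr (- a))"
  proof (cases "z < b")
    case True
    \<comment> \<open>On the support of \<open>p\<close> the transformed value exceeds
      \<open>b\<close>, hence \<open>z\<close>.\<close>
    have "p y * indicator {y. ?X y \<le> z} y = 0" for y
    proof (cases "0 < y \<and> y < u")
      case y: True
      then have "ln (y / u) < 0" by simp
      with True have "\<not> ?X y \<le> z" by simp
      then show ?thesis by simp
    qed (auto simp: p)
    then have *: "ennreal (p y) * indicator {y. ?X y \<le> z} y = 0" for y
      by (metis ennreal_0 indicator_simps mult_eq_0_iff zero_neq_one)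
    show ?thesis
      unfolding * using True by simp
  next
    case False
    \<comment> \<open>\<open>c\<close> is the solution of \<open>?X c = z\<close>; it is at most
      \<open>u\<close> because \<open>b \<le> z\<close>.\<close>
    define c where "c = u * exp (b - z)"
    have c: "0 < c" "c \<le> u"
      using assms False by (auto simp: c_def)
    have X_c: "b + ln (u / c) = z"
      using assms by (simp add: c_def ln_div ln_mult)
    have X_iff: "?X y \<le> z \<longleftrightarrow> c \<le> y" if "y > 0" for y
    proof -
      have "?X y \<le> z \<longleftrightarrow> ln c \<le> ln y"
        using assms that by (auto simp: c_def ln_div ln_mult)
      then show ?thesis using that c by simp
    qed
    have "(\<integral>\<^sup>+y. ennreal (p y) * indicator {y. ?X y \<le> z} y \<partial>lborel)
        = (\<integral>\<^sup>+y. ennreal (a * b powr a / (y * (b + ln (u / y)) powr (a + 1)))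
                * indicator {c..u} y \<partial>lborel)"
    \<comment> \<open>The two integrands can differ only at the endpoint \<open>u\<close>, where
      \<open>p\<close> is zero but the formula is not.\<close>
    proof (intro nn_integral_cong_AE eventually_mono[OF AE_lborel_singleton[of u]])
      fix y assume "y \<noteq> u"
      then show "ennreal (p y) * indicator {y. ?X y \<le> z} y
          = ennreal (a * b powr a / (y * (b + ln (u / y)) powr (a + 1))) * indicator {c..u} y"
        using c X_iff[of y] by (cases "0 < y \<and> y < u") (auto simp: p indicator_def)
    qed
    also have "\<dots> = ennreal (b powr a * (b + ln (u / u)) powr (- a)
        - b powr a * (b + ln (u / c)) powr (- a))"
    proof (rule nn_integral_FTC_Icc[where F = "\<lambda>y. b powr a * (b + ln (u / y)) powr (- a)"])
      fix y assume "y \<in> {c..u}"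
      with c have y: "0 < y" "y \<le> u" by auto
      then have pos: "b + ln (u / y) > 0"
        using assms by (simp add: add_pos_nonneg)
      have "((\<lambda>y. b + ln (u / y)) has_real_derivative - 1 / y) (at y)"
        using y assms by (auto intro!: derivative_eq_intros simp: field_simps power2_eq_square)
      \<comment> \<open>The inner derivative \<open>- 1 / y\<close> and the outer negation cancel in
        sign, so the survival function composed with the transformation increases in
        \<open>y\<close>.\<close>
      from DERIV_minus[OF DERIV_chain2[OF pareto_tail_has_derivative[OF pos, of b a] this]]
      show "((\<lambda>y. b powr a * (b + ln (u / y)) powr (- a)) has_real_derivative
             a * b powr a / (y * (b + ln (u / y)) powr (a + 1))) (at y)"
        by (simp add: mult_ac)
      show "0 \<le> a * b powr a / (y * (b + ln (u / y)) powr (a + 1))"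
        using y assms by simp
    qed (use c in auto)
    \<comment> \<open>At \<open>u\<close> the logarithm vanishes and the survival function is 1; at
      \<open>c\<close> it is evaluated at \<open>z\<close>.\<close>
    also have "b powr a * (b + ln (u / u)) powr (- a) - b powr a * (b + ln (u / c)) powr (- a)
        = 1 - b powr a * z powr (- a)"
      using assms unfolding X_c by (simp add: powr_minus)
    finally show ?thesis using False by simp
  qed
  finally show "emeasure (density lborel (\<lambda>y. ennreal (p y)))
          {y \<in> space (density lborel (\<lambda>y. ennreal (p y))). ?X y \<le> z}
      = ennreal (if z < b then 0 else 1 - b powr a * z powr (- a))" .
qed

section \<open>Parameters expressed through the geometric mean\<close>

theorem mainTheorem4:
  fixes u n0 g0 ghat gn A B :: real and n :: nat and x :: "nat \<Rightarrow> real"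
    and prior :: "real \<Rightarrow> real"
  assumes "u > 0" and "n0 > 0" and "0 < g0" and "g0 < 1" and "n \<ge> 1"
    and "\<And>i. i \<in> {1..n} \<Longrightarrow> 0 < x i \<and> x i < u"
    and "prior = gamma_density n0 (- n0 * ln g0)"
    and "ghat = (\<Prod>i=1..n. (x i / u) powr (1 / real n))"
    and "gn = (g0 powr n0 * ghat ^ n) powr (1 / (real n + n0))"
    and "A = real n + n0"
    and "B = - (real n + n0) * ln gn"
  shows "(\<forall>\<alpha>. posterior_density (power_density u) prior n x \<alpha>
              = gamma_density (real n + n0) (- (real n + n0) * ln gn) \<alpha>)
       \<and> B > 0
       \<and> (\<forall>y. 0 < y \<and> y < u \<longrightarrow>
            predictive_density (power_density u) prior n x y
              = A * B powr A / (y * (B + ln (u / y)) powr (A + 1)))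
       \<and> distributed
            (density lborel (\<lambda>y. ennreal (predictive_density (power_density u) prior n x y)))
            lborel (\<lambda>y. - ln (y / u) + B) (\<lambda>z. ennreal (pareto_density A B z))"
proof -
  define b where "b = - n0 * ln g0"
  let ?S = "\<Sum>i=1..n. ln (x i / u)"
  \<comment> \<open>The \<open>n\<close>-th power undoes the \<open>n\<close>-th roots;
    \<open>n \<ge> 1\<close> makes \<open>1 / real n * real n\<close> equal 1.\<close>
  have ghat_pow: "ghat ^ n = (\<Prod>i=1..n. x i / u)"
  proof -
    have "((x i / u) powr (1 / real n)) ^ n = x i / u" if "i \<in> {1..n}" for i
      using assms(1,5) assms(6)[OF that] by (simp add: powr_realpow[symmetric] powr_powr)
    then show ?thesis
      unfolding assms(8) prod_power_distrib by (intro prod.cong) auto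
  qed
  have pos: "x i / u > 0" if "i \<in> {1..n}" for i
    using assms(1) assms(6)[OF that] by simp
  then have ghat_pos: "ghat ^ n > 0"
    unfolding ghat_pow by (intro prod_pos) auto
  \<comment> \<open>Taking logarithms shows that \<open>B\<close> is the prior rate \<open>b\<close>
    minus the sum of the \<open>ln (x i / u)\<close>, the updated rate found by conjugacy.\<close>
  have "ln (g0 powr n0 * ghat ^ n) = n0 * ln g0 + ?S"
  proof -
    have "ln (ghat ^ n) = ?S"
      unfolding ghat_pow
      using pos by (intro ln_prod) (metis finite_atLeastAtMost less_numeral_extra(3))+
    moreover have "ln (g0 powr n0 * ghat ^ n) = ln (g0 powr n0) + ln (ghat ^ n)"
      using ghat_pos assms(3) by (intro ln_mult_pos) auto
    ultimately show ?thesis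
      using assms(3) by (simp only: ln_powr)
  qed
  then have "ln gn = (n0 * ln g0 + ?S) / (real n + n0)"
    by (simp add: assms(9) ln_powr)
  moreover have "real n + n0 \<noteq> 0"
    using assms(2) by linarith
  ultimately have "(real n + n0) * ln gn = n0 * ln g0 + ?S"
    by simp
  then have B_eq: "B = b - ?S"
    unfolding assms(11) b_def by linarith
  \<comment> \<open>\<open>g0 < 1\<close> makes the prior rate positive, and \<open>x i < u\<close>
    makes every summand of \<open>?S\<close> negative, so updating cannot lower the rate.\<close>
  have "b > 0"
    using assms(2-4) by (simp add: b_def mult_pos_neg)
  moreover have "?S \<le> 0"
    using assms(1,6) by (intro sum_nonpos) (auto simp: less_imp_le)
  ultimately have B: "B > 0"
    unfolding B_eq by linarith
  have A: "A > 0"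
    using assms(2,10) by simp
  have "(\<Prod>i=1..n. x i) > 0"
    using assms(6) by (intro prod_pos) auto
  then have "0 < b powr n0 / Gamma n0 / (\<Prod>i=1..n. x i) * (Gamma A / B powr A)"
    using \<open>b > 0\<close> B Gamma_real_pos[OF A] Gamma_real_pos[OF assms(2)]
    by (intro mult_pos_pos divide_pos_pos) auto
  \<comment> \<open>A nonzero constant cancels between the numerator of the posterior and its
    normalising integral.\<close>
  then have "b powr n0 / Gamma n0 / (\<Prod>i=1..n. x i) * (Gamma A / B powr A) \<noteq> 0"
    by (rule less_imp_neq[symmetric])
  moreover have "likelihood (power_density u) n x t * prior t
      = b powr n0 / Gamma n0 / (\<Prod>i=1..n. x i) * (Gamma A / B powr A) * gamma_density A B t" for t
    unfolding assms(7,10) b_def[symmetric]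
    by (rule likelihood_power_gamma[OF assms(6,2) B_eq B])
  ultimately have post: "posterior_density (power_density u) prior n x = gamma_density A B"
    using set_integral_gamma_density[OF A B] by (intro posterior_density_eqI)
  \<comment> \<open>The value off \<open>(0, u)\<close> is also recorded, since the law of a new
    observation is a density on the whole line; there the Power density is 0 for every
    parameter.\<close>
  have pred: "predictive_density (power_density u) prior n x y
      = (if 0 < y \<and> y < u then A * B powr A / (y * (B + ln (u / y)) powr (A + 1)) else 0)" for y
    using set_integral_power_gamma[OF A B]
    by (auto simp: predictive_density_def post power_density_eq_0)
  show ?thesis
    using B post pred distributed_neg_log_pareto[OF A B assms(1) pred]
    by (simp add: assms(10,11))
qed

end
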